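(* Let $F=\frac1n\sum_{i=1}^nF_i$ where each $F_i:\mathbb{R}^d\to\mathbb{R}^d$ is monotone, and suppose there exists an interpolating solution $x_*\in\mathbb{R}^d$, i.e. $F_i(x_* )=0$ for every $i\in[n]$. Let $\{x_k\}$ be generated by PolyakSEG from $x_0\in\mathbb{R}^d$ with step-sizes $\gamma_k>0$ chosen so that, for some fixed $A\in(0,1)$, the stochastic critical condition $$\|F_{\mathcal S_k}(\hat x_k)-F_{\mathcal S_k}(x_k)\|\le A\|F_{\mathcal S_k}(x_k)\|$$ holds for all $k\ge 0$. Then: 1. Almost surely, for every $K\ge 0$, $$\frac1{K+1}\sum_{k=0}^K\gamma_k^2\|F_{\mathcal S_k}(x_k)\|^2\le\frac{(1+A)\|x_0-x_*\|^2}{(1-A)(K+1)}.$$ 2. If, in addition, there exist constants $\mu_{\mathcal S}\ge 0$ such that $\langle F_{\mathcal S}(x)-F_{\mathcal S}(y),x-y\rangle\ge\mu_{\mathcal S}\|x-y\|^2$ for all $x,y\in\mathbb{R}^d$ and all mini-batches $\mathcal S$, then for every $k\ge 0$, $$\mathbb{E}_k\left[\|x_{k+1}-x_*\|^2\right]\le\left(1-\frac{2(1-A)}{(1+A)^2}\,\mathbb{E}_k\left[\gamma_k\mu_{\mathcal S_k}\right]\right)\|x_k-x_*\|^2,$$ where $\mathbb{E}_k[\cdot]$ denotes the conditional expectation given the randomness revealed before drawing $\mathcal S_k$.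
   Context: $\langle\cdot,\cdot\rangle$ and $\|\cdot\|$ are Euclidean; $[n]=\{1,\dots,n\}$. An operator $G$ is monotone if $\langle G(x)-G(y),x-y\rangle\ge 0$ for all $x,y$. For a mini-batch $\mathcal S$ (a finite nonempty collection of indices of $[n]$, possibly with repetition), $F_{\mathcal S}=\frac1{|\mathcal S|}\sum_{i\in\mathcal S}F_i$. At each iteration $k$ a mini-batch $\mathcal S_k$ of indices is drawn from $[n]$ uniformly with replacement, independently of the past. The step-size $\gamma_k$ may depend on the past and on $\mathcal S_k$ (e.g. via line-search), but not on future samples. PolyakSEG: given $x_0$, for $k=0,1,\dots$: sample $\mathcal S_k$ and set $$\hat x_k=x_k-\gamma_kF_{\mathcal S_k}(x_k),\quad\alpha_k=\frac{\langle F_{\mathcal S_k}(\hat x_k),x_k-\hat x_k\rangle}{\|F_{\mathcal S_k}(\hat x_k)\|^2},\quad x_{k+1}=x_k-\alpha_kF_{\mathcal S_k}(\hat x_k).$$ Convention: if $F_{\mathcal S_k}(\hat x_k)=0$, set $\alpha_k=\min\{\alpha_{k-1},\gamma_k\}$ (with $\alpha_{-1}=\infty$), so that $x_{k+1}=x_k$. *)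

theory Defs
  imports "HOL-Probability.Probability"
begin

definition monotone_operator :: "('a::real_inner \<Rightarrow> 'a) \<Rightarrow> bool" where
  "monotone_operator G \<longleftrightarrow> (\<forall>x y. inner (G x - G y) (x - y) \<ge> 0)"

definition minibatch :: "nat \<Rightarrow> nat multiset \<Rightarrow> bool" where
  "minibatch n B \<longleftrightarrow> B \<noteq> {#} \<and> set_mset B \<subseteq> {1..n}"

definition batch_op :: "(nat \<Rightarrow> 'a::real_vector \<Rightarrow> 'a) \<Rightarrow> nat multiset \<Rightarrow> 'a \<Rightarrow> 'a" where
  "batch_op Fi B x = (1 / real (size B)) *\<^sub>R (\<Sum>i\<in>#B. Fi i x)"

text \<open>The unordered outcome of \<^term>\<open>m\<close> independent uniform draws from $[n]$, i.e. of uniform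
  sampling with replacement; \<^term>\<open>mset\<close> keeps repetitions.\<close>

definition minibatch_pmf :: "nat \<Rightarrow> nat \<Rightarrow> nat multiset pmf" where
  "minibatch_pmf n m = map_pmf mset (replicate_pmf m (pmf_of_set {1..n}))"

text \<open>The sigma-algebra generated by \<^term>\<open>S j\<close> for \<^term>\<open>j < k\<close>: the randomness revealed before
  \<^term>\<open>S k\<close> is drawn. It is trivial for \<^term>\<open>k = 0\<close>, the starting point being deterministic.\<close>

definition past :: "'w measure \<Rightarrow> (nat \<Rightarrow> 'w \<Rightarrow> 'b) \<Rightarrow> nat \<Rightarrow> 'w measure" where
  "past M S k = sigma (space M) {S j -` A \<inter> space M | j A. j < k}"

text \<open>A single trajectory of PolyakSEG, for given mini-batches \<^term>\<open>B\<close> and step-sizes \<^term>\<open>\<gamma>\<close>.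
  The sequence \<^term>\<open>xh\<close> holds the extrapolation points $\hat x_k$.
  The case \<^term>\<open>0\<close> is $\min\{\alpha_{-1},\gamma_0\}$ with $\alpha_{-1}=\infty$.\<close>

definition polyak_seg ::
  "(nat \<Rightarrow> 'a::real_inner \<Rightarrow> 'a) \<Rightarrow> (nat \<Rightarrow> nat multiset) \<Rightarrow> (nat \<Rightarrow> real) \<Rightarrow> 'a
     \<Rightarrow> (nat \<Rightarrow> 'a) \<Rightarrow> (nat \<Rightarrow> 'a) \<Rightarrow> (nat \<Rightarrow> real) \<Rightarrow> bool" where
  "polyak_seg Fi B \<gamma> x0 x xh \<alpha> \<longleftrightarrow>
     x 0 = x0 \<and>
     (\<forall>k. xh k = x k - \<gamma> k *\<^sub>R batch_op Fi (B k) (x k) \<and>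
          \<alpha> k = (if batch_op Fi (B k) (xh k) = 0
                 then (case k of 0 \<Rightarrow> \<gamma> 0 | Suc j \<Rightarrow> min (\<alpha> j) (\<gamma> k))
                 else inner (batch_op Fi (B k) (xh k)) (x k - xh k)
                        / (norm (batch_op Fi (B k) (xh k)))\<^sup>2) \<and>
          x (Suc k) = x k - \<alpha> k *\<^sub>R batch_op Fi (B k) (xh k))"

end

theory Submission
  imports Defs
begin

text \<open>
  The whole theorem rests on a deterministic estimate for one step. Write \<open>g = G x\<close> and
  \<open>h = G (x - \<gamma> g)\<close> for the mini-batch operator \<open>G\<close>, which vanishes at \<open>xs\<close>. The step size \<open>\<alpha>\<close> is
  the one for which \<open>x - \<alpha> h\<close> is the projection of \<open>x\<close> onto the hyperplane through the
  extrapolation point orthogonal to \<open>h\<close>. Monotonicity puts \<open>xs\<close> on the far side of that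
  hyperplane, so the squared distance to \<open>xs\<close> drops by at least \<open>\<alpha>\<^sup>2 \<parallel>h\<parallel>\<^sup>2\<close>, and by a further
  \<open>2 \<alpha> \<mu> \<parallel>x - \<gamma> g - xs\<parallel>\<^sup>2\<close> under strong monotonicity. The critical condition
  \<open>\<parallel>h - g\<parallel> \<le> A \<parallel>g\<parallel>\<close> bounds the angle between \<open>g\<close> and \<open>h\<close> and the ratio of their lengths, which
  gives \<open>\<alpha>\<^sup>2 \<parallel>h\<parallel>\<^sup>2 \<ge> (1 - A\<^sup>2) \<gamma>\<^sup>2 \<parallel>g\<parallel>\<^sup>2\<close> and \<open>\<alpha> \<ge> \<gamma> / (1 + A)\<close>.

  The first claim is the telescoped sum of these decreases. For the second, the two decreases are
  combined through a weighted form of \<open>\<parallel>x - xs\<parallel> \<le> \<parallel>x - \<gamma> g - xs\<parallel> + \<gamma> \<parallel>g\<parallel>\<close>, using that strong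
  monotonicity and the critical condition force \<open>\<gamma> \<mu> \<le> A\<close> whenever \<open>g \<noteq> 0\<close>. The result is an almost
  sure contraction by the factor \<open>1 - c \<gamma> \<mu>\<close> with \<open>c = 2 (1 - A) / (1 + A)\<^sup>2\<close>; taking conditional
  expectations and pulling out \<open>\<parallel>x\<^sub>k - xs\<parallel>\<^sup>2\<close>, which the past determines, finishes the proof.

  Measurability of the iterates needs an argument because the operators \<open>Fi\<close> carry no regularity.
  There are only countably many mini-batches, so the past sigma-algebra is generated by a countable
  partition, and a function is measurable for it exactly when it is constant on each cell. The
  same almost sure estimates bound everything that is integrated.
\<close>

section \<open>Geometry of one extrapolated Polyak step\<close>

text \<open>Polarization of the critical condition; both later bounds on the step size come from it.\<close>

lemma critical_inner_lower:
  fixes g h :: "'a::real_inner"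
  assumes "norm (h - g) \<le> A * norm g"
  shows "(norm h)\<^sup>2 + (1 - A\<^sup>2) * (norm g)\<^sup>2 \<le> 2 * inner h g"
proof -
  have "(norm (h - g))\<^sup>2 \<le> (A * norm g)\<^sup>2"
    using assms by (intro power_mono) auto
  moreover have "(norm (h - g))\<^sup>2 = (norm h)\<^sup>2 - 2 * inner h g + (norm g)\<^sup>2"
    by (simp add: power2_norm_eq_inner algebra_simps inner_commute)
  ultimately show ?thesis
    by (simp add: power_mult_distrib algebra_simps)
qed

text \<open>The bound says \<open>cos\<^sup>2 \<ge> 1 - A\<^sup>2\<close> for the angle between the two vectors. It is the
  inequality of arithmetic and geometric means applied to the left-hand side of
  \<open>critical_inner_lower\<close>.\<close>

lemma critical_angle:
  fixes g h :: "'a::real_inner"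
  assumes "norm (h - g) \<le> A * norm g" "0 < A" "A < 1"
  shows "(1 - A\<^sup>2) * (norm g)\<^sup>2 * (norm h)\<^sup>2 \<le> (inner h g)\<^sup>2"
proof -
  define a where "a = (norm h)\<^sup>2"
  define c where "c = (1 - A\<^sup>2) * (norm g)\<^sup>2"
  have "A\<^sup>2 \<le> 1" using assms by (simp add: power_le_one)
  then have nn: "a \<ge> 0" "c \<ge> 0" unfolding a_def c_def by auto
  have "a + c \<le> 2 * inner h g"
    using critical_inner_lower[OF assms(1)] unfolding a_def c_def .
  then have "(a + c)\<^sup>2 \<le> (2 * inner h g)\<^sup>2"
    using nn by (intro power_mono) auto
  moreover have "4 * (a * c) \<le> (a + c)\<^sup>2"
    using zero_le_power2[of "a - c"] by (simp add: power2_eq_square algebra_simps)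
  ultimately have "a * c \<le> (inner h g)\<^sup>2"
    by (simp add: power_mult_distrib)
  then show ?thesis unfolding a_def c_def by (simp add: mult.commute)
qed

text \<open>Since \<open>\<parallel>h\<parallel> \<le> (1 + A) \<parallel>g\<parallel>\<close>, the term \<open>(1 - A\<^sup>2) \<parallel>g\<parallel>\<^sup>2\<close> in \<open>critical_inner_lower\<close> is at least
  \<open>(1 - A) / (1 + A) \<parallel>h\<parallel>\<^sup>2\<close>.\<close>

lemma critical_inner_ge_norm_sq:
  fixes g h :: "'a::real_inner"
  assumes "norm (h - g) \<le> A * norm g" "0 < A" "A < 1"
  shows "(norm h)\<^sup>2 \<le> (1 + A) * inner h g"
proof -
  have "norm h \<le> (1 + A) * norm g"
    using assms(1) norm_triangle_sub[of h g] by (simp add: algebra_simps)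
  then have "(norm h)\<^sup>2 \<le> ((1 + A) * norm g)\<^sup>2" by (intro power_mono) auto
  then have "(1 - A) * (norm h)\<^sup>2 \<le> (1 - A) * ((1 + A) * norm g)\<^sup>2"
    using assms by (intro mult_left_mono) auto
  also have "\<dots> = (1 + A) * ((1 - A\<^sup>2) * (norm g)\<^sup>2)"
    by (simp add: power2_eq_square algebra_simps)
  also have "\<dots> \<le> (1 + A) * (2 * inner h g - (norm h)\<^sup>2)"
    using critical_inner_lower[OF assms(1)] assms(2) by (intro mult_left_mono) auto
  finally show ?thesis by (simp add: algebra_simps)
qed

text \<open>Taking \<open>\<mu> = 0\<close> covers plain monotonicity, so both claims are instances of this locale.\<close>

locale polyak_step =
  fixes G :: "'a::real_inner \<Rightarrow> 'a" and \<mu> \<gamma> \<alpha> A :: real and xs x :: 'a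
  assumes strong: "\<And>y z. \<mu> * (norm (y - z))\<^sup>2 \<le> inner (G y - G z) (y - z)"
    and mu_nonneg: "0 \<le> \<mu>"
    and zero: "G xs = 0"
    and A: "0 < A" "A < 1"
    and gamma_pos: "0 < \<gamma>"
    and critical: "norm (G (x - \<gamma> *\<^sub>R G x) - G x) \<le> A * norm (G x)"
    and alpha: "G (x - \<gamma> *\<^sub>R G x) \<noteq> 0 \<Longrightarrow>
      \<alpha> = inner (G (x - \<gamma> *\<^sub>R G x)) (\<gamma> *\<^sub>R G x) / (norm (G (x - \<gamma> *\<^sub>R G x)))\<^sup>2"
begin

abbreviation "xh \<equiv> x - \<gamma> *\<^sub>R G x"
abbreviation "next_x \<equiv> x - \<alpha> *\<^sub>R G xh"

lemma operator_zero_if_extrapolated_zero: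
  assumes "G xh = 0" shows "G x = 0"
proof (rule ccontr)
  assume "G x \<noteq> 0"
  with A have "A * norm (G x) < norm (G x)" by simp
  with critical assms show False by simp
qed

lemma alpha_ge:
  assumes "G xh \<noteq> 0" shows "\<gamma> / (1 + A) \<le> \<alpha>"
proof -
  have "(norm (G xh))\<^sup>2 > 0" using assms by simp
  moreover have "\<gamma> * (norm (G xh))\<^sup>2 \<le> \<gamma> * ((1 + A) * inner (G xh) (G x))"
    using critical_inner_ge_norm_sq[OF critical A] gamma_pos by (intro mult_left_mono) auto
  ultimately show ?thesis
    using A unfolding alpha[OF assms] by (simp add: field_simps)
qed

lemma displacement_ge:
  "(1 - A\<^sup>2) * (\<gamma>\<^sup>2 * (norm (G x))\<^sup>2) \<le> \<alpha>\<^sup>2 * (norm (G xh))\<^sup>2"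
proof (cases "G xh = 0")
  case True
  then show ?thesis using operator_zero_if_extrapolated_zero by simp
next
  case False
  define N where "N = (norm (G xh))\<^sup>2"
  have N: "N > 0" unfolding N_def using False by simp
  have "(1 - A\<^sup>2) * (\<gamma>\<^sup>2 * (norm (G x))\<^sup>2) * N \<le> \<gamma>\<^sup>2 * (inner (G xh) (G x))\<^sup>2"
    using mult_left_mono[OF critical_angle[OF critical A], of "\<gamma>\<^sup>2"]
    unfolding N_def by (simp add: algebra_simps)
  also have "\<dots> = \<alpha>\<^sup>2 * N * N"
    using N unfolding alpha[OF False] N_def[symmetric] by (simp add: power2_eq_square)
  finally show ?thesis using N unfolding N_def[symmetric] by simp
qed

text \<open>The Polyak step size makes \<open>\<alpha> \<parallel>h\<parallel>\<^sup>2\<close> equal to \<open>\<langle>h, x - xh\<rangle>\<close>. Splitting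
  \<open>x - xs = (x - xh) + (xh - xs)\<close> in the cross term, the first part contributes twice the
  quadratic term and the second is controlled by strong monotonicity.\<close>

lemma distance_decrease:
  "(norm (next_x - xs))\<^sup>2 \<le>
     (norm (x - xs))\<^sup>2 - 2 * \<alpha> * \<mu> * (norm (xh - xs))\<^sup>2 - \<alpha>\<^sup>2 * (norm (G xh))\<^sup>2"
    if "G xh \<noteq> 0"
proof -
  define h where "h = G xh"
  have "\<alpha> \<ge> 0" using alpha_ge[OF that] A gamma_pos
    by (meson add_pos_pos divide_pos_pos less_imp_le order_trans zero_less_one)
  moreover have "\<mu> * (norm (xh - xs))\<^sup>2 \<le> inner h (xh - xs)"
    using strong[of xh xs] zero unfolding h_def by simp
  ultimately have sm: "\<alpha> * (\<mu> * (norm (xh - xs))\<^sup>2) \<le> \<alpha> * inner h (xh - xs)"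
    by (rule mult_left_mono[rotated])
  have proj: "inner h (x - xh) = \<alpha> * (norm h)\<^sup>2"
    using that unfolding alpha[OF that] h_def by simp
  have "next_x - xs = (x - xs) - \<alpha> *\<^sub>R h" unfolding h_def by simp
  then have "(norm (next_x - xs))\<^sup>2 = (norm (x - xs))\<^sup>2 - 2 * \<alpha> * inner h (x - xs) + \<alpha>\<^sup>2 * (norm h)\<^sup>2"
    by (simp only: power2_norm_eq_inner)
      (simp add: inner_diff_left inner_diff_right inner_commute power2_eq_square algebra_simps)
  moreover have "inner h (x - xs) = \<alpha> * (norm h)\<^sup>2 + inner h (xh - xs)"
    unfolding proj[symmetric] by (simp add: inner_diff)
  ultimately show ?thesis using sm unfolding h_def[symmetric]
    by (simp add: power2_eq_square algebra_simps)
qed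

lemma distance_decrease_extrapolation:
  "(norm (next_x - xs))\<^sup>2 \<le> (norm (x - xs))\<^sup>2 - (1 - A\<^sup>2) * (\<gamma>\<^sup>2 * (norm (G x))\<^sup>2)"
proof (cases "G xh = 0")
  case True
  then show ?thesis using operator_zero_if_extrapolated_zero by simp
next
  case False
  have "\<gamma> / (1 + A) > 0" using A gamma_pos by simp
  then have "0 \<le> 2 * \<alpha> * \<mu> * (norm (xh - xs))\<^sup>2"
    using alpha_ge[OF False] mu_nonneg by simp
  then show ?thesis using distance_decrease[OF False] displacement_ge by linarith
qed

text \<open>A strongly monotone operator must vary by at least \<open>\<mu> \<gamma> \<parallel>G x\<parallel>\<close> along the extrapolation step,
  which the critical condition caps by \<open>A \<parallel>G x\<parallel>\<close>.\<close>

lemma gamma_mu_le: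
  assumes "G x \<noteq> 0" shows "\<gamma> * \<mu> \<le> A"
proof -
  define r where "r = norm (G x)"
  have r: "r > 0" using assms by (simp add: r_def)
  have "\<mu> * (norm (xh - x))\<^sup>2 \<le> norm (G xh - G x) * norm (xh - x)"
    using strong[of xh x] norm_cauchy_schwarz order_trans by blast
  also have "\<dots> \<le> A * r * norm (xh - x)"
    using critical unfolding r_def by (intro mult_right_mono) auto
  also have "norm (xh - x) = \<gamma> * r" using gamma_pos by (simp add: r_def)
  finally have "(\<gamma> * \<mu>) * (\<gamma> * r * r) \<le> A * (\<gamma> * r * r)"
    by (simp add: power2_eq_square algebra_simps)
  then show ?thesis using r gamma_pos by (simp add: mult.commute[of \<mu>])
qed

lemma mu_distance_zero:
  assumes "G x = 0" shows "\<mu> * (norm (x - xs))\<^sup>2 = 0"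
proof (rule antisym)
  show "\<mu> * (norm (x - xs))\<^sup>2 \<le> 0" using strong[of x xs] zero assms by simp
qed (use mu_nonneg in simp)

lemma gamma_mu_distance_le:
  "\<gamma> * \<mu> * (norm (x - xs))\<^sup>2 \<le> A * (norm (x - xs))\<^sup>2"
proof (cases "G x = 0")
  case True
  then show ?thesis using mu_distance_zero A by (auto simp: mult.assoc)
next
  case False
  then show ?thesis using gamma_mu_le by (intro mult_right_mono) auto
qed

end

text \<open>The triangle inequality squared with weights \<open>(1 + t)\<close> and \<open>(1 + 1/t)\<close> at
  \<open>t = 2 A / (1 - A)\<close>, cleared of denominators.\<close>

lemma norm_add_sq_weighted:
  fixes u v :: "'a::real_inner"
  assumes "0 < A" "A < 1"
  shows "2 * A * (1 - A) * (norm (u + v))\<^sup>2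
    \<le> 2 * A * (1 + A) * (norm u)\<^sup>2 + (1 + A) * (1 - A) * (norm v)\<^sup>2"
proof -
  have "0 \<le> (norm ((2 * A) *\<^sub>R u - (1 - A) *\<^sub>R v))\<^sup>2" by simp
  then show ?thesis
    by (simp only: power2_norm_eq_inner)
      (simp add: inner_add inner_diff inner_commute algebra_simps)
qed

context polyak_step
begin

text \<open>The weights of \<open>norm_add_sq_weighted\<close> are chosen so that the \<open>\<parallel>xh - xs\<parallel>\<^sup>2\<close> term is absorbed
  exactly by \<open>2 \<alpha> \<mu> \<parallel>xh - xs\<parallel>\<^sup>2\<close> with \<open>\<alpha> \<ge> \<gamma> / (1 + A)\<close>. The remaining term
  \<open>\<gamma> \<mu> (1 - A) / (A (1 + A)) \<gamma>\<^sup>2 \<parallel>G x\<parallel>\<^sup>2\<close> is absorbed by the displacement because \<open>\<gamma> \<mu> \<le> A\<close>.\<close>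

lemma contraction:
  "(norm (next_x - xs))\<^sup>2 \<le> (1 - 2 * (1 - A) / (1 + A)\<^sup>2 * (\<gamma> * \<mu>)) * (norm (x - xs))\<^sup>2"
proof (cases "G xh = 0")
  case True
  have "\<gamma> * \<mu> * (norm (x - xs))\<^sup>2 = 0"
    using mu_distance_zero[OF operator_zero_if_extrapolated_zero[OF True]] by (simp add: mult.assoc)
  then show ?thesis using True by (auto simp: algebra_simps)
next
  case False
  define d where "d = (norm (x - xs))\<^sup>2"
  define p where "p = (norm (xh - xs))\<^sup>2"
  define q where "q = \<gamma>\<^sup>2 * (norm (G x))\<^sup>2"
  define m where "m = \<gamma> * \<mu>"
  have nn: "p \<ge> 0" "q \<ge> 0" "m \<ge> 0" using gamma_pos mu_nonneg by (auto simp: p_def q_def m_def)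
  have m_le: "m \<le> A" if "q > 0"
  proof -
    have "G x \<noteq> 0" using that by (auto simp: q_def)
    then show ?thesis using gamma_mu_le by (simp add: m_def)
  qed
  have mq: "m * q \<le> A * q" using m_le nn by (cases "q = 0") (auto intro: mult_right_mono)
  have "x - xs = (xh - xs) + \<gamma> *\<^sub>R G x" by simp
  then have "2 * A * (1 - A) * d \<le> 2 * A * (1 + A) * p + (1 + A) * (1 - A) * q"
    using norm_add_sq_weighted[OF A, of "xh - xs" "\<gamma> *\<^sub>R G x"]
    by (simp add: d_def p_def q_def power_mult_distrib)
  then have "m * (2 * A * (1 - A) * d) \<le> m * (2 * A * (1 + A) * p + (1 + A) * (1 - A) * q)"
    using nn by (intro mult_left_mono)
  also have "\<dots> = 2 * A * (1 + A) * (m * p) + (1 + A) * (1 - A) * (m * q)"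
    by (simp add: algebra_simps)
  also have "\<dots> \<le> 2 * A * (1 + A) * (m * p) + (1 + A) * (1 - A) * (A * q)"
    using mq A by (intro add_left_mono mult_left_mono) auto
  finally have "A * (2 * (1 - A) * m * d) \<le> A * ((1 + A) * (2 * m * p + (1 - A) * q))"
    by (simp add: algebra_simps)
  then have "2 * (1 - A) * m * d \<le> (1 + A) * (2 * m * p + (1 - A) * q)"
    using A by simp
  then have "2 * (1 - A) * m * d / (1 + A)\<^sup>2 \<le> (1 + A) * (2 * m * p + (1 - A) * q) / (1 + A)\<^sup>2"
    by (intro divide_right_mono) auto
  also have "\<dots> = 2 * (m / (1 + A)) * p + (1 - A) / (1 + A) * q"
    using A by (simp add: power2_eq_square field_simps)
  also have "\<dots> \<le> 2 * (\<alpha> * \<mu>) * p + (1 - A\<^sup>2) * q"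
  proof (intro add_mono mult_right_mono mult_left_mono)
    show "m / (1 + A) \<le> \<alpha> * \<mu>"
      using mult_right_mono[OF alpha_ge[OF False] mu_nonneg] by (simp add: m_def)
    have "(1 - A) / (1 + A) \<le> 1 - A" using A by (simp add: field_simps)
    also have "\<dots> \<le> 1 - A\<^sup>2" using A by (simp add: power2_eq_square)
    finally show "(1 - A) / (1 + A) \<le> 1 - A\<^sup>2" .
  qed (use nn in auto)
  also have "\<dots> \<le> d - (norm (next_x - xs))\<^sup>2"
    using distance_decrease[OF False] displacement_ge by (simp add: d_def p_def q_def)
  finally show ?thesis by (simp add: d_def m_def algebra_simps)
qed

end

section \<open>Mini-batch operators\<close>

lemma batch_op_monotone:
  assumes "minibatch n B" and "\<And>i. i \<in> {1..n} \<Longrightarrow> monotone_operator (Fi i)"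
  shows "0 \<le> inner (batch_op Fi B y - batch_op Fi B z) (y - z)"
proof -
  have "set_mset B \<subseteq> {1..n}" using assms(1) by (simp add: minibatch_def)
  then have "0 \<le> inner ((\<Sum>i\<in>#B. Fi i y) - (\<Sum>i\<in>#B. Fi i z)) (y - z)"
  proof (induction B)
    case (add i B)
    then have "0 \<le> inner (Fi i y - Fi i z) (y - z)"
      using assms(2) by (auto simp: monotone_operator_def)
    with add show ?case by (simp add: inner_diff inner_add)
  qed simp
  then show ?thesis
    by (simp add: batch_op_def scaleR_diff_right[symmetric])
qed

lemma batch_op_interpolation:
  assumes "minibatch n B" and "\<And>i. i \<in> {1..n} \<Longrightarrow> Fi i z = 0"
  shows "batch_op Fi B z = 0"
proof -
  have "set_mset B \<subseteq> {1..n}" using assms(1) by (simp add: minibatch_def)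
  then have "(\<Sum>i\<in>#B. Fi i z) = 0"
    using assms(2) by (induction B) auto
  then show ?thesis by (simp add: batch_op_def)
qed

lemma minibatch_pmf_minibatch:
  assumes "n \<ge> 1" "m \<ge> 1" "B \<in> set_pmf (minibatch_pmf n m)"
  shows "minibatch n B"
proof -
  have "set_pmf (pmf_of_set {1..n}) = {1..n}"
    using assms(1) by (intro set_pmf_of_set) auto
  then obtain l where "B = mset l" "length l = m" "set l \<subseteq> {1..n}"
    using assms(3) unfolding minibatch_pmf_def set_map_pmf set_replicate_pmf
    by (auto simp: lists_eq_set)
  then show ?thesis using assms(2) by (auto simp: minibatch_def)
qed

lemma polyak_seg_next:
  assumes "polyak_seg Fi B \<gamma> x0 x xh \<alpha>"
  shows "xh k = x k - \<gamma> k *\<^sub>R batch_op Fi (B k) (x k)"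
    and "x (Suc k) = x k - \<alpha> k *\<^sub>R batch_op Fi (B k) (xh k)"
    and "batch_op Fi (B k) (xh k) \<noteq> 0 \<Longrightarrow> \<alpha> k =
      inner (batch_op Fi (B k) (xh k)) (x k - xh k) / (norm (batch_op Fi (B k) (xh k)))\<^sup>2"
  using assms unfolding polyak_seg_def by auto

lemma polyak_seg_step:
  fixes Fi :: "nat \<Rightarrow> 'a::real_inner \<Rightarrow> 'a"
  assumes "polyak_seg Fi B \<gamma> x0 x xh \<alpha>"
    and "\<And>y z. \<mu> * (norm (y - z))\<^sup>2 \<le> inner (batch_op Fi (B k) y - batch_op Fi (B k) z) (y - z)"
    and "0 \<le> \<mu>" "batch_op Fi (B k) xs = 0" "0 < A" "A < 1" "0 < \<gamma> k"
    and "norm (batch_op Fi (B k) (xh k) - batch_op Fi (B k) (x k)) \<le> A * norm (batch_op Fi (B k) (x k))"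
  shows "polyak_step (batch_op Fi (B k)) \<mu> (\<gamma> k) (\<alpha> k) A xs (x k)"
    and "x (Suc k) = x k - \<alpha> k *\<^sub>R batch_op Fi (B k) (x k - \<gamma> k *\<^sub>R batch_op Fi (B k) (x k))"
proof -
  note seg = polyak_seg_next[OF assms(1), of k]
  show "polyak_step (batch_op Fi (B k)) \<mu> (\<gamma> k) (\<alpha> k) A xs (x k)"
    using assms(2-8) seg(3) unfolding seg(1) by unfold_locales auto
  show "x (Suc k) = x k - \<alpha> k *\<^sub>R batch_op Fi (B k) (x k - \<gamma> k *\<^sub>R batch_op Fi (B k) (x k))"
    using seg(2) unfolding seg(1) .
qed

text \<open>The step is zero if the operator vanishes at the extrapolation point and is given by the
  Polyak formula otherwise; in both cases it is a function of the current iterate, mini-batch and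
  step size.\<close>

lemma polyak_seg_determined:
  fixes Fi :: "nat \<Rightarrow> 'a::real_inner \<Rightarrow> 'a"
  assumes seg: "polyak_seg Fi B \<gamma> x0 x xh \<alpha>" "polyak_seg Fi B' \<gamma>' x0 x' xh' \<alpha>'"
    and "\<And>j. j < k \<Longrightarrow> B j = B' j" "\<And>j. j < k \<Longrightarrow> \<gamma> j = \<gamma>' j"
  shows "x k = x' k"
  using assms(3,4)
proof (induction k)
  case 0
  then show ?case using seg by (simp add: polyak_seg_def)
next
  case (Suc k)
  then have eq: "x k = x' k" "B k = B' k" "\<gamma> k = \<gamma>' k" by auto
  then have "xh k = xh' k"
    using polyak_seg_next(1)[OF seg(1)] polyak_seg_next(1)[OF seg(2)] by simp
  with eq show ?case
    using polyak_seg_next(2,3)[OF seg(1), of k] polyak_seg_next(2,3)[OF seg(2), of k]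
    by (cases "batch_op Fi (B k) (xh k) = 0") auto
qed

section \<open>The sigma-algebra of a countable-valued past\<close>

lemma space_past [simp]: "space (past M S k) = space M"
  unfolding past_def by (rule space_measure_of) auto

lemma sets_past: "sets (past M S k) = sigma_sets (space M) {S j -` A \<inter> space M | j A. j < k}"
  unfolding past_def by (rule sets_measure_of) auto

lemma subalgebra_past:
  assumes "\<And>j. S j \<in> measurable M (count_space UNIV)"
  shows "subalgebra M (past M S k)"
  unfolding subalgebra_def sets_past
  using assms by (auto intro!: sets.sigma_sets_subset intro: measurable_sets)

lemma past_generator_sets: "j < k \<Longrightarrow> S j -` A \<inter> space M \<in> sets (past M S k)"
  unfolding sets_past by (rule sigma_sets.Basic) auto

text \<open>Sets that do not separate outcomes with the same history form a sigma-algebra which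
  contains the generators.\<close>

lemma past_sets_saturated:
  assumes "E \<in> sets (past M S k)" "\<omega> \<in> space M" "\<omega>' \<in> space M"
    and "\<And>j. j < k \<Longrightarrow> S j \<omega> = S j \<omega>'"
  shows "\<omega> \<in> E \<longleftrightarrow> \<omega>' \<in> E"
  using assms(1) unfolding sets_past
proof (induction rule: sigma_sets.induct)
  case (Basic a)
  then show ?case using assms by auto
qed (use assms in auto)

lemma past_measurable_determined:
  fixes f :: "'w \<Rightarrow> 'c::t1_space"
  assumes "f \<in> borel_measurable (past M S k)" "\<omega> \<in> space M" "\<omega>' \<in> space M"
    and "\<And>j. j < k \<Longrightarrow> S j \<omega> = S j \<omega>'"
  shows "f \<omega> = f \<omega>'"
proof -
  have "f -` {f \<omega>} \<inter> space (past M S k) \<in> sets (past M S k)"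
    using assms(1) by (rule measurable_sets) simp
  from past_sets_saturated[OF this assms(2-)] show ?thesis
    using assms(2,3) by simp
qed

text \<open>The history \<open>[S 0, \<dots>, S (k - 1)]\<close> takes values in a countable set, so it is measurable
  for the discrete sigma-algebra and any function of it, however wild, is measurable.\<close>

lemma past_measurable_if_determined:
  fixes S :: "nat \<Rightarrow> 'w \<Rightarrow> 'b"
  assumes cnt: "countable (UNIV :: 'b set)"
    and det: "\<And>\<omega> \<omega>'. \<omega> \<in> space M \<Longrightarrow> \<omega>' \<in> space M \<Longrightarrow> (\<And>j. j < k \<Longrightarrow> S j \<omega> = S j \<omega>') \<Longrightarrow> f \<omega> = f \<omega>'"
    and "f \<in> space M \<rightarrow> space N"
  shows "f \<in> measurable (past M S k) N"
proof -
  define H where "H \<omega> = map (\<lambda>j. S j \<omega>) [0..<k]" for \<omega>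
  have cl: "countable (UNIV :: 'b list set)"
    using countable_lists[OF cnt] by simp
  have fib: "{\<omega> \<in> space M. H \<omega> = l} \<in> sets (past M S k)" for l
  proof (cases "length l = k")
    case True
    then have "{\<omega> \<in> space M. H \<omega> = l} =
        {\<omega> \<in> space (past M S k). \<forall>j\<in>{..<k}. \<omega> \<in> S j -` {l ! j} \<inter> space M}"
      by (auto simp: H_def list_eq_iff_nth_eq)
    also have "\<dots> \<in> sets (past M S k)"
    proof (rule sets.sets_Collect_finite_All)
      fix j assume "j \<in> {..<k}"
      then have "S j -` {l ! j} \<inter> space M \<in> sets (past M S k)"
        by (auto intro: past_generator_sets)
      then show "{\<omega> \<in> space (past M S k). \<omega> \<in> S j -` {l ! j} \<inter> space M} \<in> sets (past M S k)"
        by (simp add: Collect_conj_eq vimage_def Int_commute Int_left_absorb)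
    qed simp
    finally show ?thesis .
  next
    case False
    then have "{\<omega> \<in> space M. H \<omega> = l} = {}" by (auto simp: H_def)
    then show ?thesis by (simp only: sets.empty_sets)
  qed
  show ?thesis
  proof (rule measurableI)
    fix \<omega> assume "\<omega> \<in> space (past M S k)"
    then show "f \<omega> \<in> space N" using assms(3) by auto
  next
    fix E
    have "f -` E \<inter> space M = (\<Union>l\<in>H ` (f -` E \<inter> space M). {\<omega> \<in> space M. H \<omega> = l})"
    proof (intro equalityI subsetI)
      fix \<omega> assume "\<omega> \<in> (\<Union>l\<in>H ` (f -` E \<inter> space M). {\<omega> \<in> space M. H \<omega> = l})"
      then obtain \<omega>' where *: "\<omega>' \<in> f -` E \<inter> space M" "\<omega> \<in> space M" "H \<omega> = H \<omega>'" by auto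
      then have "f \<omega> = f \<omega>'" by (intro det) (auto simp: H_def)
      with * show "\<omega> \<in> f -` E \<inter> space M" by simp
    qed auto
    also have "\<dots> \<in> sets (past M S k)"
      by (intro sets.countable_UN' countable_subset[OF subset_UNIV cl]) (use fib in auto)
    finally show "f -` E \<inter> space (past M S k) \<in> sets (past M S k)" by simp
  qed
qed

lemma countable_multisets: "countable (UNIV :: 'a::countable multiset set)"
proof -
  have "(UNIV :: 'a multiset set) = range mset"
    using ex_mset by (metis surj_def)
  then show ?thesis by (metis countableI_type countable_image)
qed

section \<open>From pathwise to conditional contraction\<close>

text \<open>The inequality for \<open>W\<close> is averaged over the new randomness, and \<open>V\<close> is pulled out of the
  conditional expectation. Integrability is asked of the product \<open>V * \<rho>\<close> because that is the
  quantity with an a priori bound: a step size obeys no upper bound where the operator vanishes,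
  but there strong monotonicity makes the product zero.\<close>

lemma (in sigma_finite_subalgebra) real_cond_exp_contraction:
  fixes V W \<rho> :: "'a \<Rightarrow> real"
  assumes V: "V \<in> borel_measurable F" "integrable M V" and W: "integrable M W"
    and \<rho>: "\<rho> \<in> borel_measurable M" "integrable M (\<lambda>\<omega>. V \<omega> * \<rho> \<omega>)"
    and le: "AE \<omega> in M. W \<omega> \<le> (1 - c * \<rho> \<omega>) * V \<omega>"
  shows "AE \<omega> in M. real_cond_exp M F W \<omega> \<le> (1 - c * real_cond_exp M F \<rho> \<omega>) * V \<omega>"
proof -
  have int: "integrable M (\<lambda>\<omega>. c * (V \<omega> * \<rho> \<omega>))" using \<rho>(2) by simp
  have "AE \<omega> in M. W \<omega> \<le> V \<omega> - c * (V \<omega> * \<rho> \<omega>)"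
    using le by (simp add: algebra_simps)
  then have "AE \<omega> in M. real_cond_exp M F W \<omega> \<le> real_cond_exp M F (\<lambda>\<omega>. V \<omega> - c * (V \<omega> * \<rho> \<omega>)) \<omega>"
    by (rule real_cond_exp_mono[OF _ W Bochner_Integration.integrable_diff[OF V(2) int]])
  then show ?thesis
    using real_cond_exp_diff[OF V(2) int] real_cond_exp_F_meas[OF V(2,1)]
      real_cond_exp_cmult[OF \<rho>(2), of c] real_cond_exp_mult[OF V(1) \<rho>]
  proof eventually_elim
    case (elim \<omega>)
    then show ?case by (simp add: algebra_simps)
  qed
qed

section \<open>Convergence of PolyakSEG\<close>

theorem theorem4p3:
  fixes n :: nat
    and Fi :: "nat \<Rightarrow> real ^ 'd \<Rightarrow> real ^ 'd"
    and F :: "real ^ 'd \<Rightarrow> real ^ 'd"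
    and xs x0 :: "real ^ 'd"
    and M :: "'w measure"
    and b :: "nat \<Rightarrow> nat"
    and S :: "nat \<Rightarrow> 'w \<Rightarrow> nat multiset"
    and \<gamma> \<alpha> :: "nat \<Rightarrow> 'w \<Rightarrow> real"
    and x xh :: "nat \<Rightarrow> 'w \<Rightarrow> real ^ 'd"
    and A :: real
  assumes n_pos: "n \<ge> 1"
    and F_mean: "\<And>z. F z = (1 / real n) *\<^sub>R (\<Sum>i=1..n. Fi i z)"
    and mono: "\<And>i. i \<in> {1..n} \<Longrightarrow> monotone_operator (Fi i)"
    and interpolation: "\<And>i. i \<in> {1..n} \<Longrightarrow> Fi i xs = 0"
    and prob: "prob_space M"
    and batch_size: "\<And>k. b k \<ge> 1"
    and indep: "prob_space.indep_vars M (\<lambda>_. count_space UNIV) S UNIV"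
    and uniform: "\<And>k. distr M (count_space UNIV) (S k) = measure_pmf (minibatch_pmf n (b k))"
    and step_adapted: "\<And>k. \<gamma> k \<in> borel_measurable (past M S (Suc k))"
    and seg: "\<And>\<omega>. \<omega> \<in> space M \<Longrightarrow>
        polyak_seg Fi (\<lambda>k. S k \<omega>) (\<lambda>k. \<gamma> k \<omega>) x0 (\<lambda>k. x k \<omega>) (\<lambda>k. xh k \<omega>) (\<lambda>k. \<alpha> k \<omega>)"
    and step_pos: "AE \<omega> in M. \<forall>k. \<gamma> k \<omega> > 0"
    and A: "0 < A" "A < 1"
    and critical: "AE \<omega> in M. \<forall>k.
        norm (batch_op Fi (S k \<omega>) (xh k \<omega>) - batch_op Fi (S k \<omega>) (x k \<omega>))
          \<le> A * norm (batch_op Fi (S k \<omega>) (x k \<omega>))"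
  shows "(AE \<omega> in M. \<forall>K. (1 / real (K + 1)) *
            (\<Sum>k=0..K. (\<gamma> k \<omega>)\<^sup>2 * (norm (batch_op Fi (S k \<omega>) (x k \<omega>)))\<^sup>2)
              \<le> (1 + A) * (norm (x0 - xs))\<^sup>2 / ((1 - A) * real (K + 1))) \<and>
         (\<forall>\<mu> :: nat multiset \<Rightarrow> real.
            (\<forall>B. minibatch n B \<longrightarrow> \<mu> B \<ge> 0 \<and>
               (\<forall>y z. inner (batch_op Fi B y - batch_op Fi B z) (y - z) \<ge> \<mu> B * (norm (y - z))\<^sup>2)) \<longrightarrow>
            (\<forall>k. AE \<omega> in M.
               real_cond_exp M (past M S k) (\<lambda>\<omega>'. (norm (x (Suc k) \<omega>' - xs))\<^sup>2) \<omega>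
                 \<le> (1 - 2 * (1 - A) / (1 + A)\<^sup>2 *
                        real_cond_exp M (past M S k) (\<lambda>\<omega>'. \<gamma> k \<omega>' * \<mu> (S k \<omega>')) \<omega>)
                    * (norm (x k \<omega> - xs))\<^sup>2))"
proof -
  interpret prob_space M by (rule prob)
  have S_meas [measurable]: "S k \<in> measurable M (count_space UNIV)" for k
    using indep by (auto simp: indep_vars_def2)
  have sub: "subalgebra M (past M S k)" for k
    by (rule subalgebra_past) (rule S_meas)

  define Q where "Q \<omega> \<longleftrightarrow> (\<forall>k. minibatch n (S k \<omega>) \<and> \<gamma> k \<omega> > 0 \<and>
      norm (batch_op Fi (S k \<omega>) (xh k \<omega>) - batch_op Fi (S k \<omega>) (x k \<omega>))
          \<le> A * norm (batch_op Fi (S k \<omega>) (x k \<omega>)))" for \<omega>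
  have "AE \<omega> in M. minibatch n (S k \<omega>)" for k
  proof (rule AE_distrD[OF S_meas])
    show "AE B in distr M (count_space UNIV) (S k). minibatch n B"
      unfolding uniform using minibatch_pmf_minibatch[OF n_pos batch_size] by (rule AE_pmfI)
  qed
  then have "AE \<omega> in M. \<forall>k. minibatch n (S k \<omega>)" by (simp add: AE_all_countable)
  with step_pos critical have Q: "AE \<omega> in M. Q \<omega>"
    unfolding Q_def by eventually_elim auto

  have step: "polyak_step (batch_op Fi (S k \<omega>)) m (\<gamma> k \<omega>) (\<alpha> k \<omega>) A xs (x k \<omega>)"
      "x (Suc k) \<omega> = x k \<omega> - \<alpha> k \<omega> *\<^sub>R
         batch_op Fi (S k \<omega>) (x k \<omega> - \<gamma> k \<omega> *\<^sub>R batch_op Fi (S k \<omega>) (x k \<omega>))"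
    if "\<omega> \<in> space M" "Q \<omega>" "0 \<le> m"
      "\<And>y z. m * (norm (y - z))\<^sup>2 \<le> inner (batch_op Fi (S k \<omega>) y - batch_op Fi (S k \<omega>) z) (y - z)"
    for \<omega> k m
  proof -
    have z: "batch_op Fi (S k \<omega>) xs = 0"
      using that(2) interpolation by (intro batch_op_interpolation) (auto simp: Q_def)
    note * = polyak_seg_step[OF seg[OF that(1)] that(4,3) z A]
    show "polyak_step (batch_op Fi (S k \<omega>)) m (\<gamma> k \<omega>) (\<alpha> k \<omega>) A xs (x k \<omega>)"
      "x (Suc k) \<omega> = x k \<omega> - \<alpha> k \<omega> *\<^sub>R
         batch_op Fi (S k \<omega>) (x k \<omega> - \<gamma> k \<omega> *\<^sub>R batch_op Fi (S k \<omega>) (x k \<omega>))"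
      using that(2) * unfolding Q_def by blast+
  qed

  define V where "V k \<omega> = (norm (x k \<omega> - xs))\<^sup>2" for k \<omega>
  define T where "T k \<omega> = (\<gamma> k \<omega>)\<^sup>2 * (norm (batch_op Fi (S k \<omega>) (x k \<omega>)))\<^sup>2" for k \<omega>
  have decrease: "V (Suc k) \<omega> \<le> V k \<omega> - (1 - A\<^sup>2) * T k \<omega>" if "\<omega> \<in> space M" "Q \<omega>" for \<omega> k
  proof -
    have "0 * (norm (y - z))\<^sup>2 \<le> inner (batch_op Fi (S k \<omega>) y - batch_op Fi (S k \<omega>) z) (y - z)"
      for y z
      using batch_op_monotone[of n "S k \<omega>" Fi y z] mono that(2) by (simp add: Q_def)
    note s = step[OF that order_refl this]
    show ?thesis
      using polyak_step.distance_decrease_extrapolation[OF s(1)] s(2) by (simp add: V_def T_def)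
  qed
  have V_0: "V 0 \<omega> = (norm (x0 - xs))\<^sup>2" if "\<omega> \<in> space M" for \<omega>
    using seg[OF that] by (simp add: V_def polyak_seg_def)
  have A2: "0 < 1 - A\<^sup>2" using A by (simp add: power_less_one_iff)
  have telescope: "V k \<omega> + (1 - A\<^sup>2) * (\<Sum>j<k. T j \<omega>) \<le> (norm (x0 - xs))\<^sup>2"
    if "\<omega> \<in> space M" "Q \<omega>" for \<omega> k
  proof (induction k)
    case 0
    then show ?case using V_0[OF that(1)] by simp
  next
    case (Suc k)
    then show ?case using decrease[OF that, of k] by (simp add: algebra_simps)
  qed
  have T_nonneg: "0 \<le> T k \<omega>" for k \<omega> by (simp add: T_def)
  have V_nonneg: "0 \<le> V k \<omega>" for k \<omega> by (simp add: V_def)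
  have V_le: "V k \<omega> \<le> (norm (x0 - xs))\<^sup>2" if "\<omega> \<in> space M" "Q \<omega>" for \<omega> k
  proof -
    have "0 \<le> (1 - A\<^sup>2) * (\<Sum>j<k. T j \<omega>)"
      using A2 by (intro mult_nonneg_nonneg sum_nonneg T_nonneg) auto
    then show ?thesis using telescope[OF that, of k] by linarith
  qed

  have claim1: "AE \<omega> in M. \<forall>K. (1 / real (K + 1)) * (\<Sum>k=0..K. T k \<omega>)
      \<le> (1 + A) * (norm (x0 - xs))\<^sup>2 / ((1 - A) * real (K + 1))"
    using Q
  proof (rule AE_mp, intro AE_I2 impI allI)
    fix \<omega> K assume \<omega>: "\<omega> \<in> space M" "Q \<omega>"
    define s where "s = (\<Sum>k=0..K. T k \<omega>)"
    have s_nonneg: "0 \<le> s" unfolding s_def by (intro sum_nonneg T_nonneg)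
    have s_eq: "s = (\<Sum>k<Suc K. T k \<omega>)" unfolding s_def by (intro sum.cong) auto
    have "(1 - A\<^sup>2) * s \<le> (norm (x0 - xs))\<^sup>2"
      using telescope[OF \<omega>, of "Suc K"] V_nonneg[of "Suc K" \<omega>] unfolding s_eq by linarith
    moreover have "(1 - A) * s \<le> (1 + A) * ((1 - A\<^sup>2) * s)"
    proof -
      have "1 * ((1 - A) * s) \<le> (1 + A)\<^sup>2 * ((1 - A) * s)"
        using A s_nonneg by (intro mult_right_mono) (auto simp: one_le_power)
      then show ?thesis by (simp add: power2_eq_square algebra_simps)
    qed
    ultimately have "(1 - A) * s \<le> (1 + A) * (norm (x0 - xs))\<^sup>2"
      using A mult_left_mono[of "(1 - A\<^sup>2) * s" "(norm (x0 - xs))\<^sup>2" "1 + A"] by linarith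
    then have "s \<le> (1 + A) * (norm (x0 - xs))\<^sup>2 / (1 - A)"
      using A by (simp add: pos_le_divide_eq mult.commute)
    then have "s / real (K + 1) \<le> (1 + A) * (norm (x0 - xs))\<^sup>2 / (1 - A) / real (K + 1)"
      by (intro divide_right_mono) auto
    then show "(1 / real (K + 1)) * s \<le> (1 + A) * (norm (x0 - xs))\<^sup>2 / ((1 - A) * real (K + 1))"
      by simp
  qed

  \<comment> \<open>The step size at time \<open>j\<close> is determined by the mini-batches up to \<open>j\<close>, so the iterate at time
    \<open>k\<close> is determined by the mini-batches before \<open>k\<close>.\<close>
  have V_past: "V k \<in> borel_measurable (past M S k)" for k
  proof (rule past_measurable_if_determined)
    fix \<omega> \<omega>' assume \<omega>: "\<omega> \<in> space M" "\<omega>' \<in> space M" and eq: "\<And>j. j < k \<Longrightarrow> S j \<omega> = S j \<omega>'"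
    have "\<gamma> j \<omega> = \<gamma> j \<omega>'" if "j < k" for j
      using past_measurable_determined[OF step_adapted \<omega>] eq that by simp
    then have "x k \<omega> = x k \<omega>'"
      using polyak_seg_determined[OF seg[OF \<omega>(1)] seg[OF \<omega>(2)]] eq by blast
    then show "V k \<omega> = V k \<omega>'" by (simp add: V_def)
  qed (auto simp: countable_multisets)
  have V_meas [measurable]: "V k \<in> borel_measurable M" for k
    using measurable_from_subalg[OF sub V_past] .
  have \<gamma>_meas [measurable]: "\<gamma> k \<in> borel_measurable M" for k
    using measurable_from_subalg[OF sub step_adapted] .
  have V_int: "integrable M (V k)" for k
  proof (rule integrable_const_bound)
    show "AE \<omega> in M. norm (V k \<omega>) \<le> (norm (x0 - xs))\<^sup>2"
      using Q by (rule AE_mp) (auto intro!: AE_I2 simp: V_nonneg V_le)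
  qed simp

  have claim2: "AE \<omega> in M. real_cond_exp M (past M S k) (V (Suc k)) \<omega>
      \<le> (1 - 2 * (1 - A) / (1 + A)\<^sup>2 *
             real_cond_exp M (past M S k) (\<lambda>\<omega>'. \<gamma> k \<omega>' * \<mu> (S k \<omega>')) \<omega>) * V k \<omega>"
    if \<mu>: "\<forall>B. minibatch n B \<longrightarrow> \<mu> B \<ge> 0 \<and>
      (\<forall>y z. inner (batch_op Fi B y - batch_op Fi B z) (y - z) \<ge> \<mu> B * (norm (y - z))\<^sup>2)" for \<mu> k
  proof -
    interpret sigma_finite_subalgebra M "past M S k"
      by (intro finite_measure_subalgebra_is_sigma_finite finite_measure_subalgebra.intro
          finite_measure_subalgebra_axioms.intro sub finite_measure_axioms)
    have [measurable]: "(\<lambda>\<omega>. \<mu> (S k \<omega>)) \<in> borel_measurable M"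
      by (rule measurable_compose[OF S_meas]) simp
    have s: "polyak_step (batch_op Fi (S k \<omega>)) (\<mu> (S k \<omega>)) (\<gamma> k \<omega>) (\<alpha> k \<omega>) A xs (x k \<omega>)"
        "x (Suc k) \<omega> = x k \<omega> - \<alpha> k \<omega> *\<^sub>R
         batch_op Fi (S k \<omega>) (x k \<omega> - \<gamma> k \<omega> *\<^sub>R batch_op Fi (S k \<omega>) (x k \<omega>))"
      if "\<omega> \<in> space M" "Q \<omega>" for \<omega>
      by (rule step; use \<mu> that in \<open>auto simp: Q_def\<close>)+
    have bound: "AE \<omega> in M. norm (V k \<omega> * (\<gamma> k \<omega> * \<mu> (S k \<omega>))) \<le> A * (norm (x0 - xs))\<^sup>2"
      using Q
    proof (rule AE_mp, intro AE_I2 impI)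
      fix \<omega> assume \<omega>: "\<omega> \<in> space M" "Q \<omega>"
      have "0 \<le> \<gamma> k \<omega> * \<mu> (S k \<omega>)" using \<omega>(2) \<mu> by (simp add: Q_def less_imp_le)
      then have "norm (V k \<omega> * (\<gamma> k \<omega> * \<mu> (S k \<omega>))) = \<gamma> k \<omega> * \<mu> (S k \<omega>) * V k \<omega>"
        using V_nonneg[of k \<omega>] by (simp add: abs_of_nonneg mult.commute[of "V k \<omega>"])
      also have "\<dots> \<le> A * V k \<omega>"
        using polyak_step.gamma_mu_distance_le[OF s(1)[OF \<omega>]] by (simp add: V_def)
      also have "\<dots> \<le> A * (norm (x0 - xs))\<^sup>2"
        using A V_le[OF \<omega>] by (intro mult_left_mono) auto
      finally show "norm (V k \<omega> * (\<gamma> k \<omega> * \<mu> (S k \<omega>))) \<le> A * (norm (x0 - xs))\<^sup>2" .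
    qed
    show ?thesis
    proof (rule real_cond_exp_contraction[OF V_past V_int V_int])
      show "integrable M (\<lambda>\<omega>. V k \<omega> * (\<gamma> k \<omega> * \<mu> (S k \<omega>)))"
        using bound by (rule integrable_const_bound) measurable
      show "AE \<omega> in M. V (Suc k) \<omega> \<le> (1 - 2 * (1 - A) / (1 + A)\<^sup>2 * (\<gamma> k \<omega> * \<mu> (S k \<omega>))) * V k \<omega>"
        using Q
      proof (rule AE_mp, intro AE_I2 impI)
        fix \<omega> assume \<omega>: "\<omega> \<in> space M" "Q \<omega>"
        show "V (Suc k) \<omega> \<le> (1 - 2 * (1 - A) / (1 + A)\<^sup>2 * (\<gamma> k \<omega> * \<mu> (S k \<omega>))) * V k \<omega>"
          using polyak_step.contraction[OF s(1)[OF \<omega>]] unfolding V_def s(2)[OF \<omega>] .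
      qed
    qed measurable
  qed
  show ?thesis
    using claim1 claim2 unfolding V_def T_def by blast
qed

end
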